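(* Let $p$ be a prime with $p\equiv1\pmod 4$, and write $p=c^2+d^2$ with $c,d\in\mathbb Z$ and $2\mid d$. Let $b,m\in\mathbb Z$ with $\gcd(b,m)=1$ and $p\nmid m(b^2+4m^2)$. Then $$\Big(\frac mp\Big)\sum_{k=0}^{(p-1)/4}\binom{4k}{2k}\Big(-\frac{b^2}{64m^2}\Big)^k\equiv\Big(\frac bp\Big)\sum_{k=0}^{(p-1)/4}\binom{4k}{2k}\Big(-\frac{m^2}{4b^2}\Big)^k$$ $$\equiv\begin{cases}\Big(\frac{bc+2md}{b^2+4m^2}\Big)\pmod p&\text{if }2\nmid b\text{ and }\big(\frac{b^2+4m^2}{p}\big)=1,\\[2pt] (-1)^{\frac{((b/2)c+md)^2-1}{8}+\frac d2}\Big(\frac{(b/2)c+md}{((b/2)^2+m^2)/2}\Big)\pmod p&\text{if }2\,\|\,b\text{ and }\big(\frac{b^2+4m^2}{p}\big)=1,\\[2pt] \Big(\frac{mc-(b/2)d}{b^2/4+m^2}\Big)\pmod p&\text{if }4\mid b\text{ and }\big(\frac{b^2+4m^2}{p}\big)=1,\\[2pt] 0\pmod p&\text{if }\big(\frac{b^2+4m^2}{p}\big)=-1.\end{cases}$$ In particular, for $a\in\mathbb Z$ with $p\nmid 16a^2+1$, $$\sum_{k=0}^{(p-1)/4}\binom{4k}{2k}(-a^2)^k\equiv\Big(\frac{2a}p\Big)\sum_{k=0}^{(p-1)/4}\binom{4k}{2k}\frac1{(-256a^2)^k}\equiv\begin{cases}\Big(\frac{c-4ad}{16a^2+1}\Big)\pmod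 p&\text{if }\big(\frac{16a^2+1}p\big)=1,\\ 0\pmod p&\text{if }\big(\frac{16a^2+1}p\big)=-1.\end{cases}$$
   Context: For rational numbers whose denominators are prime to $p$, congruences modulo $p$ are understood in the ring of such rationals. $\big(\frac{x}{n}\big)$ denotes the Legendre–Jacobi symbol (for odd positive $n$); $\big(\frac{x}{p}\big)$ for such a rational $x$ means the Legendre symbol of its residue mod $p$. $2\,\|\,b$ means $2\mid b$ but $4\nmid b$.
   Formalization: Congruences involving the second sum (with b², resp. a², in the denominator) are claimed only when p∤b (resp. p∤a), since they fail or are undefined otherwise; the congruence of the first sum with the case value is proved without this restriction. *)

theory Defs
  imports Complex_Main "HOL-Number_Theory.Number_Theory"
begin

text \<open>Congruence modulo \<open>p\<close> in the ring of rationals whose denominator is prime to \<open>p\<close>.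
  Both sides are required to lie in that ring.\<close>

definition p_integral :: "nat \<Rightarrow> rat \<Rightarrow> bool" where
  "p_integral p x \<longleftrightarrow> coprime (snd (quotient_of x)) (int p)"

definition rat_cong :: "nat \<Rightarrow> rat \<Rightarrow> rat \<Rightarrow> bool" where
  "rat_cong p x y \<longleftrightarrow>
     p_integral p x \<and> p_integral p y \<and> (\<exists>z. p_integral p z \<and> x - y = of_nat p * z)"

text \<open>The Legendre--Jacobi symbol; meaningful for odd positive \<open>n\<close> only.\<close>

definition Jacobi :: "int \<Rightarrow> int \<Rightarrow> int" where
  "Jacobi a n = (\<Prod>q\<in>#prime_factorization n. Legendre a q)"

definition central_sum :: "nat \<Rightarrow> rat \<Rightarrow> rat" where
  "central_sum p x = (\<Sum>k = 0..(p - 1) div 4. of_nat ((4 * k) choose (2 * k)) * x ^ k)"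

end

theory Submission
  imports Defs
begin

text \<open>
  Modulo \<open>p = 2h + 1\<close> one has \<open>binom(2j, j) \<equiv> (-4)^j binom(h, j)\<close>, so if \<open>x \<equiv> y\<^sup>2\<close> the even part of
  the binomial expansion of \<open>(1 + 4y)^h\<close> shows that twice the sum is
  \<open>((1 - 4y)/p) + ((1 + 4y)/p)\<close>. For both arguments \<open>x\<close> of the theorem such a \<open>y\<close> exists
  because \<open>-1 \<equiv> (d/c)\<^sup>2\<close>, and since \<open>(c/p) = 1\<close> and \<open>(d/p) = (2/p)\<close>, both expressions become
  half of \<open>((bc + 2md)/p) + ((bc - 2md)/p)\<close>. The product of these two symbols is
  \<open>((b\<^sup>2 + 4m\<^sup>2)/p)\<close>, so they cancel or coincide.

  To turn \<open>((bc + 2md)/p)\<close> into a Jacobi symbol, put \<open>t = uc + vd\<close>, \<open>s = ud - vc\<close> and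
  \<open>u\<^sup>2 + v\<^sup>2 = en\<close> with \<open>n\<close> odd. Then \<open>t\<^sup>2 + s\<^sup>2 = enp\<close>, so \<open>enp\<close> is a square modulo \<open>t\<close>; all prime
  factors of \<open>np\<close> are \<open>1\<close> modulo \<open>4\<close>, so reciprocity gives \<open>(t/p)(t/n) = (np/t) = (e/t)\<close>.
  The cases of the theorem use \<open>e = 1\<close> and \<open>e = 2\<close>.
\<close>

section \<open>Legendre and Jacobi symbols\<close>

lemma Legendre_range: "Legendre a q \<in> {-1, 0, 1}"
  by (simp add: Legendre_def)

lemma Legendre_eq_0_iff: "Legendre a q = 0 \<longleftrightarrow> q dvd a"
  by (simp add: Legendre_def cong_0_iff)

lemma Legendre_cong:
  assumes "[a = b] (mod q)"
  shows "Legendre a q = Legendre b q"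
proof -
  have "[a = 0] (mod q) \<longleftrightarrow> [b = 0] (mod q)" "QuadRes q a \<longleftrightarrow> QuadRes q b"
    using assms unfolding QuadRes_def by (meson cong_sym cong_trans)+
  then show ?thesis by (simp add: Legendre_def)
qed

lemma Legendre_square:
  assumes "prime q" "\<not> q dvd a"
  shows "Legendre (a\<^sup>2) q = 1"
  using assms by (auto simp: Legendre_def cong_0_iff QuadRes_def dest: prime_dvd_power intro: cong_refl)

lemma Legendre_euler:
  fixes q :: int
  assumes "prime q" "2 < q"
  shows "[Legendre a q = a ^ nat ((q - 1) div 2)] (mod q)"
proof -
  have "prime (nat q)" "2 < nat q" "int (nat q) = q" "(nat q - 1) div 2 = nat ((q - 1) div 2)"
    using assms by auto
  then show ?thesis
    using euler_criterion[of "nat q" a] by simp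
qed

text \<open>Two of these values differ by at most 2, which is less than \<open>q\<close>. This turns
  congruences coming from Euler's criterion into equalities of symbols.\<close>

lemma cong_small_int_eq:
  fixes x y q :: int
  assumes "2 < q" "x \<in> {-1, 0, 1}" "y \<in> {-1, 0, 1}" "[x = y] (mod q)"
  shows "x = y"
proof (rule ccontr)
  assume "x \<noteq> y"
  moreover have "q dvd x - y"
    using assms(4) by (simp add: cong_iff_dvd_diff)
  ultimately have "\<bar>q\<bar> \<le> \<bar>x - y\<bar>"
    by (intro dvd_imp_le_int) auto
  then show False using assms(1-3) by auto
qed

lemma Legendre_mult:
  fixes q :: int
  assumes "prime q" "2 < q"
  shows "Legendre (a * b) q = Legendre a q * Legendre b q"
proof (rule cong_small_int_eq[OF assms(2) Legendre_range])
  show "Legendre a q * Legendre b q \<in> {-1, 0, 1}"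
    using Legendre_range[of a q] Legendre_range[of b q] by auto
  have "[a ^ nat ((q - 1) div 2) * b ^ nat ((q - 1) div 2) = Legendre a q * Legendre b q] (mod q)"
    by (intro cong_mult cong_sym[OF Legendre_euler] assms)
  then show "[Legendre (a * b) q = Legendre a q * Legendre b q] (mod q)"
    using cong_trans[OF Legendre_euler[OF assms, of "a * b"]] by (simp add: power_mult_distrib)
qed

lemma Legendre_minus_one:
  fixes q :: int
  assumes "prime q" "2 < q"
  shows "Legendre (- 1) q = (if [q = 1] (mod 4) then 1 else - 1)"
proof (rule cong_small_int_eq[OF assms(2) Legendre_range])
  have "odd q" using assms prime_odd_int by blast
  then have "even (nat ((q - 1) div 2)) \<longleftrightarrow> [q = 1] (mod 4)"
    using assms(2) by (simp add: even_nat_iff cong_def) presburger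
  then have "(- 1) ^ nat ((q - 1) div 2) = (if [q = 1] (mod 4) then 1 else - 1 :: int)"
    by (simp add: minus_one_power_iff)
  then show "[Legendre (- 1) q = (if [q = 1] (mod 4) then 1 else - 1)] (mod q)"
    using Legendre_euler[OF assms, of "- 1"] by argo
qed simp

text \<open>Gauss's lemma with multiplier 2: among the doubles of 1, ..., \<open>h\<close>, those
  exceeding \<open>h\<close> come from the numbers above \<open>h div 2\<close>, so the sign is (-1)
  to the power \<open>h - h div 2\<close>, whose parity is read off from \<open>q\<close> modulo
  8.\<close>

lemma Legendre_two:
  fixes q :: int
  assumes "prime q" "2 < q"
  shows "Legendre 2 q = (if q mod 8 \<in> {1, 7} then 1 else - 1)"
proof -
  define h where "h = (q - 1) div 2"
  have "odd q" using assms prime_odd_int by blast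
  then have h: "q = 2 * h + 1" unfolding h_def by presburger
  interpret GAUSS "nat q" 2
  proof
    show "prime (nat q)" "2 < nat q" using assms by auto
    show "[2 \<noteq> 0] (mod int (nat q))"
      using assms by (auto simp: cong_0_iff dest: zdvd_imp_le)
  qed simp
  \<comment> \<open>The doubles of numbers up to \<open>h\<close> stay below \<open>q\<close>, so
    the reduction modulo \<open>q\<close> in \<open>C\<close> changes nothing.\<close>
  have C: "C = (\<lambda>x. x * 2) ` {0<..h}"
    unfolding C_def B_def A_def image_image
    by (rule image_cong) (use assms h in auto)
  have E: "E = (\<lambda>x. x * 2) ` {h div 2<..h}"
  proof -
    have "(int (nat q) - 1) div 2 = h" using assms h by simp
    then have "E = (\<lambda>x. x * 2) ` {0<..h} \<inter> {h<..}" unfolding E_def C by simp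
    moreover have "0 < h" using assms h by simp
    ultimately show ?thesis by auto
  qed
  have "card E = nat (h - h div 2)"
    unfolding E by (subst card_image) (auto simp: inj_on_def)
  moreover have "even (nat (h - h div 2)) \<longleftrightarrow> q mod 8 \<in> {1, 7}"
  proof -
    have "0 \<le> h - h div 2" using assms h by linarith
    moreover have "even (h - h div 2) \<longleftrightarrow> (2 * h + 1) mod 8 \<in> {1, 7}"
      by simp presburger
    ultimately show ?thesis unfolding h by (simp only: even_nat_iff)
  qed
  moreover have "Legendre 2 q = (- 1) ^ card E"
    using gauss_lemma assms(2) by simp
  ultimately show ?thesis
    by (simp only: minus_one_power_iff)
qed

text \<open>The sign in the reciprocity law has the exponent (q-1)/2 times (r-1)/2, which is even
  because \<open>q\<close> is 1 modulo 4.\<close>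

lemma Legendre_reciprocity:
  fixes q r :: int
  assumes "prime q" "[q = 1] (mod 4)" "prime r" "2 < r"
  shows "Legendre r q = Legendre q r"
proof (cases "q = r")
  case False
  have q: "2 < q"
    using assms(1,2) prime_ge_2_int[of q] by (cases "q = 2") (auto simp: cong_def)
  have "even ((q - 1) div 2)"
    using assms(2) by (simp add: cong_def) presburger
  then have "even (nat ((q - 1) div 2 * ((r - 1) div 2)))"
    using q assms(4) by (simp add: even_nat_iff)
  then have "Legendre q r * Legendre r q = 1"
    using Quadratic_Reciprocity_int[of q r] assms q False
    by simp
  then show ?thesis
    using Legendre_range[of q r] Legendre_range[of r q] by auto
qed simp

section \<open>The Jacobi symbol: multiplicativity, the supplement for 2 and reciprocity\<close>

lemma Jacobi_prime: "prime q \<Longrightarrow> Jacobi a q = Legendre a q"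
  by (simp add: Jacobi_def prime_factorization_prime)

lemma Jacobi_unit: "is_unit n \<Longrightarrow> Jacobi a n = 1"
  by (simp add: Jacobi_def prime_factorization_unit)

lemma Jacobi_mult_right:
  "m \<noteq> 0 \<Longrightarrow> n \<noteq> 0 \<Longrightarrow> Jacobi a (m * n) = Jacobi a m * Jacobi a n"
  by (simp add: Jacobi_def prime_factorization_mult)

lemma odd_prime_factor_gt_2:
  fixes n q :: int
  assumes "odd n" "q \<in># prime_factorization n"
  shows "prime q \<and> 2 < q"
proof -
  have "prime q" "q dvd n" using assms by (auto simp: in_prime_factors_iff)
  then show ?thesis using assms(1) prime_ge_2_int[of q] by (cases "q = 2") auto
qed

lemma Jacobi_mult_left:
  assumes "odd n"
  shows "Jacobi (a * b) n = Jacobi a n * Jacobi b n"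
proof -
  have "Jacobi (a * b) n = (\<Prod>q\<in>#prime_factorization n. Legendre a q * Legendre b q)"
    unfolding Jacobi_def
    by (intro arg_cong[of _ _ prod_mset] image_mset_cong Legendre_mult)
       (use odd_prime_factor_gt_2[OF assms] in auto)
  then show ?thesis by (simp add: Jacobi_def prod_mset.distrib)
qed

lemma Jacobi_cong:
  assumes "[a = b] (mod n)"
  shows "Jacobi a n = Jacobi b n"
  unfolding Jacobi_def
  by (intro arg_cong[of _ _ prod_mset] image_mset_cong Legendre_cong)
     (use assms in \<open>auto simp: in_prime_factors_iff intro: cong_dvd_modulus\<close>)

lemma Jacobi_square:
  assumes "coprime a n"
  shows "Jacobi (a\<^sup>2) n = 1"
proof -
  have "Jacobi (a\<^sup>2) n = (\<Prod>q\<in>#prime_factorization n. 1)"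
    unfolding Jacobi_def
  proof (intro arg_cong[of _ _ prod_mset] image_mset_cong Legendre_square)
    fix q assume "q \<in># prime_factorization n"
    then have "prime q" "q dvd n" by (auto simp: in_prime_factors_iff)
    then show "prime q" "\<not> q dvd a"
      using assms not_prime_unit coprime_common_divisor by blast+
  qed
  then show ?thesis by simp
qed

lemma Jacobi_range: "Jacobi a n \<in> {-1, 0, 1}"
proof -
  have "prod_mset (image_mset (Legendre a) M) \<in> {-1, 0, 1}" for M
  proof (induction M)
    case (add q M)
    then show ?case using Legendre_range[of a q] by auto
  qed simp
  then show ?thesis by (simp add: Jacobi_def)
qed

text \<open>Both sides are multiplicative in \<open>n\<close>, since {1, 7} is a subgroup of index 2
  in the odd residues modulo 8. Negative \<open>n\<close> are covered: neither side changes under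
  \<open>n\<close> to \<open>-n\<close>. This matters because the lemma is applied to u c + v d,
  whose sign is unknown.\<close>

lemma Jacobi_two:
  assumes "odd n"
  shows "Jacobi 2 n = (if n mod 8 \<in> {1, 7} then 1 else - 1)"
  using assms
proof (induction n rule: prime_divisors_induct)
  case (unit n)
  then have "n = 1 \<or> n = - 1" by auto
  with unit show ?case by (auto simp: Jacobi_unit)
next
  case (factor q n)
  then have q: "prime q" "2 < q" "odd q" "odd n" "n \<noteq> 0"
    using prime_ge_2_int[of q] by (cases "q = 2"; auto)+
  have "q mod 8 \<in> {1, 3, 5, 7}" "n mod 8 \<in> {1, 3, 5, 7}"
    using q(3,4) by (simp; presburger)+
  then have "q * n mod 8 \<in> {1, 7} \<longleftrightarrow> (q mod 8 \<in> {1, 7}) = (n mod 8 \<in> {1, 7})"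
    unfolding mod_mult_eq[of q 8 n, symmetric] by (elim insertE emptyE) simp_all
  moreover have "Jacobi 2 (q * n) = (if q mod 8 \<in> {1, 7} then 1 else - 1)
      * (if n mod 8 \<in> {1, 7} then 1 else - 1)"
    using q factor.IH by (simp add: Jacobi_mult_right Jacobi_prime Legendre_two)
  ultimately show ?case by (simp split: if_split)
qed simp

text \<open>Induction over the prime factors of \<open>m\<close> by reciprocity for primes. The sign
  of \<open>m\<close> is harmless because -1 is a square modulo \<open>q\<close>.\<close>

lemma Legendre_eq_Jacobi_swap:
  fixes q m :: int
  assumes "prime q" "[q = 1] (mod 4)" "odd m"
  shows "Legendre m q = Jacobi q m"
  using assms(3)
proof (induction m rule: prime_divisors_induct)
  case (unit m)
  have q: "2 < q"
    using assms(1,2) prime_ge_2_int[of q] by (cases "q = 2") (auto simp: cong_def)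
  have "m = 1 \<or> m = - 1" using unit by auto
  moreover have "Legendre 1 q = 1"
    using Legendre_square[of q 1] q assms(1) by auto
  ultimately show ?case
    using Legendre_minus_one[OF assms(1) q] assms(2) unit by (auto simp: Jacobi_unit)
next
  case (factor r m)
  have q: "2 < q"
    using assms(1,2) prime_ge_2_int[of q] by (cases "q = 2") (auto simp: cong_def)
  have r: "prime r" "2 < r" "odd m" "m \<noteq> 0" "r \<noteq> 0"
    using factor prime_ge_2_int[of r] by (cases "r = 2"; auto)+
  have "Legendre (r * m) q = Legendre r q * Legendre m q"
    using assms(1) q by (rule Legendre_mult)
  also have "\<dots> = Jacobi q r * Jacobi q m"
    using factor.IH r Legendre_reciprocity[OF assms(1,2) r(1,2)] by (simp add: Jacobi_prime)
  finally show ?case using r by (simp add: Jacobi_mult_right)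
qed simp

text \<open>When every prime factor of \<open>n\<close> is 1 modulo 4, each step of the induction
  over these factors is free of signs. Hence \<open>m\<close> may be negative, and it may share
  factors with \<open>n\<close>.\<close>

lemma Jacobi_reciprocity:
  fixes n m :: int
  assumes "\<And>q. prime q \<Longrightarrow> q dvd n \<Longrightarrow> [q = 1] (mod 4)" "0 < n" "odd m"
  shows "Jacobi m n = Jacobi n m"
  using assms(1,2)
proof (induction n rule: prime_divisors_induct)
  case (unit n)
  then have "n = 1" by auto
  then show ?case using Jacobi_square[of 1 m] by (simp add: Jacobi_unit)
next
  case (factor q n)
  have q: "prime q" "[q = 1] (mod 4)" "0 < q" using factor by (auto simp: prime_gt_0_int)
  have n: "0 < n" using factor.prems(2) q(3) by (simp add: zero_less_mult_iff)
  have "Jacobi m (q * n) = Legendre m q * Jacobi m n"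
    using q n by (simp add: Jacobi_mult_right Jacobi_prime)
  also have "\<dots> = Jacobi q m * Jacobi n m"
    using factor.IH factor.prems n Legendre_eq_Jacobi_swap[OF q(1,2) assms(3)] by simp
  finally show ?case using assms(3) by (simp add: Jacobi_mult_left)
qed simp

section \<open>Prime factors of sums of two squares, and reciprocity for u c + v d\<close>

lemma prime_factor_sum_squares:
  fixes u v r :: int
  assumes "coprime u v" "prime r" "2 < r" "r dvd u\<^sup>2 + v\<^sup>2"
  shows "[r = 1] (mod 4)"
proof -
  have v: "\<not> r dvd v" and u: "\<not> r dvd u"
  proof -
    have "r dvd u \<longleftrightarrow> r dvd v"
      using assms(2,4) dvd_add_left_iff dvd_add_right_iff prime_dvd_power_iff[of r 2]
      by (metis zero_less_numeral)
    then show "\<not> r dvd v" "\<not> r dvd u"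
      using assms(1,2) not_prime_unit coprime_common_divisor by blast+
  qed
  \<comment> \<open>As \<open>r\<close> divides neither \<open>u\<close> nor \<open>v\<close>, this
    exhibits -1 as the square of u/v modulo \<open>r\<close>.\<close>
  have "[u\<^sup>2 = - 1 * v\<^sup>2] (mod r)"
    using assms(4) by (simp add: cong_iff_dvd_diff)
  then have "Legendre (- 1) r = 1"
    using Legendre_cong[of "u\<^sup>2" "- 1 * v\<^sup>2" r] Legendre_mult[of r "- 1" "v\<^sup>2"]
      Legendre_square[of r u] Legendre_square[of r v] assms(2,3) u v by simp
  then show ?thesis
    using Legendre_minus_one[OF assms(2,3)] by (auto split: if_splits)
qed

text \<open>Used with \<open>e = 1\<close> when u^2 + v^2 is odd, and with \<open>e = 2\<close> when
  \<open>u\<close> and \<open>v\<close> are both odd. The second conclusion shows that neither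
  symbol on the left of the first one vanishes.\<close>

lemma Legendre_sum_squares_reciprocity:
  fixes p c d u v e n :: int
  assumes p: "prime p" "[p = 1] (mod 4)" "p = c\<^sup>2 + d\<^sup>2"
    and uv: "coprime u v" "u\<^sup>2 + v\<^sup>2 = e * n" "\<not> p dvd u\<^sup>2 + v\<^sup>2" "odd n" "0 < n"
    and odd: "odd (u * c + v * d)"
  shows "Legendre (u * c + v * d) p * Jacobi (u * c + v * d) n = Jacobi e (u * c + v * d)"
    and "Jacobi e (u * c + v * d) \<noteq> 0"
proof -
  define t where "t = u * c + v * d"
  define s where "s = u * d - v * c"
  have ts: "t\<^sup>2 + s\<^sup>2 = (u\<^sup>2 + v\<^sup>2) * p"
    unfolding t_def s_def p(3) by (simp add: power2_eq_square algebra_simps)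
  have "coprime s t"
  proof (rule ccontr)
    assume "\<not> coprime s t"
    moreover have "t \<noteq> 0" using odd unfolding t_def[symmetric] by auto
    then have "gcd s t \<noteq> 0" by simp
    ultimately obtain r where r: "prime r" "r dvd s" "r dvd t"
      using prime_divisor_exists[of "gcd s t"] by (auto simp: coprime_iff_gcd_eq_1)
    \<comment> \<open>Solving for \<open>u\<close> and \<open>v\<close> in terms of \<open>t\<close>
      and \<open>s\<close>; the determinant of the system is -p. As \<open>u\<close> and
      \<open>v\<close> are coprime, a common prime \<open>r\<close> of \<open>s\<close> and
      \<open>t\<close> must be \<open>p\<close>, and then p^2 divides (u^2 + v^2) p, which is
      excluded.\<close>
    have "u * p = c * t + d * s" "v * p = d * t - c * s"
      unfolding t_def s_def p(3) by (simp_all add: power2_eq_square algebra_simps)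
    then have "r dvd u * p" "r dvd v * p" using r by auto
    then have "r dvd p"
      using r(1) uv(1) not_prime_unit coprime_common_divisor by (metis prime_dvd_mult_iff)
    then have "r = p" using r(1) p(1) primes_dvd_imp_eq by blast
    then have "p * p dvd t\<^sup>2 + s\<^sup>2"
      using r by (simp add: power2_eq_square mult_dvd_mono)
    then show False using ts uv(3) p(1) by auto
  qed
  have "Jacobi e t * Jacobi (n * p) t = Jacobi (e * (n * p)) t"
    using odd by (simp add: Jacobi_mult_left t_def)
  also have "\<dots> = Jacobi (s\<^sup>2) t"
  proof (rule Jacobi_cong)
    have "e * (n * p) - s\<^sup>2 = t\<^sup>2" using ts uv(2) by (simp add: algebra_simps)
    then show "[e * (n * p) = s\<^sup>2] (mod t)"
      by (simp add: cong_iff_dvd_diff power2_eq_square)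
  qed
  also have "\<dots> = 1" using \<open>coprime s t\<close> by (rule Jacobi_square)
  finally have 1: "Jacobi e t * Jacobi (n * p) t = 1" .
  have "[q = 1] (mod 4)" if "prime q" "q dvd n * p" for q
  proof -
    from that have "q dvd n \<or> q = p"
      using p(1) by (auto simp: prime_dvd_mult_iff dest: primes_dvd_imp_eq)
    moreover have "[q = 1] (mod 4)" if "q dvd n"
    proof (rule prime_factor_sum_squares[OF uv(1) \<open>prime q\<close>])
      show "2 < q" using \<open>prime q\<close> uv(4) that prime_ge_2_int[of q] by (cases "q = 2") auto
      show "q dvd u\<^sup>2 + v\<^sup>2" using that uv(2) by simp
    qed
    ultimately show ?thesis using p(2) by auto
  qed
  then have "Jacobi t (n * p) = Jacobi (n * p) t"
    using uv(5) p(1) odd by (intro Jacobi_reciprocity) (auto simp: t_def prime_gt_0_int)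
  then have "Jacobi t n * Legendre t p = Jacobi (n * p) t"
    using uv(5) p(1) by (simp add: Jacobi_mult_right Jacobi_prime prime_gt_0_int)
  then show "Legendre t p * Jacobi t n = Jacobi e t"
    using 1 Jacobi_range[of e t] by (auto simp: mult.commute)
  show "Jacobi e t \<noteq> 0" using 1 by auto
qed

text \<open>Identifies the sign with exponent (t^2 - 1)/8 in the theorem as (2/t).\<close>

lemma even_square_minus_one_div_8:
  fixes t :: int
  assumes "odd t"
  shows "even ((t\<^sup>2 - 1) div 8) \<longleftrightarrow> t mod 8 \<in> {1, 7}"
proof -
  define k r where "k = t div 8" and "r = t mod 8"
  have t: "t = 8 * k + r" by (simp add: k_def r_def)
  have r: "r \<in> {1, 3, 5, 7}" unfolding r_def using assms by simp presburger
  \<comment> \<open>Replacing \<open>t\<close> by its residue \<open>r\<close> changes t^2 by a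
    multiple of 16, hence the quotient by 8 by an even number; four residues remain.\<close>
  have "t\<^sup>2 - 1 = (r\<^sup>2 - 1) + 8 * (2 * (4 * k\<^sup>2 + k * r))"
    unfolding t by (simp add: power2_eq_square algebra_simps)
  then have "(t\<^sup>2 - 1) div 8 = (r\<^sup>2 - 1) div 8 + 2 * (4 * k\<^sup>2 + k * r)"
    by simp
  then have "even ((t\<^sup>2 - 1) div 8) \<longleftrightarrow> even ((r\<^sup>2 - 1) div 8)" by simp
  also have "\<dots> \<longleftrightarrow> r \<in> {1, 7}" using r by auto
  finally show ?thesis by (simp only: r_def)
qed

section \<open>Congruences of rationals\<close>

text \<open>The reduced denominator divides every other one, so integrality may be tested on any
  fraction representing \<open>x\<close>. The closure properties rest on this.\<close>

lemma p_integral_iff: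
  assumes "prime p"
  shows "p_integral p x \<longleftrightarrow> (\<exists>a e. \<not> int p dvd e \<and> x = of_int a / of_int e)"
proof
  assume L: "p_integral p x"
  obtain a e where q: "quotient_of x = (a, e)" by fastforce
  then have "coprime e (int p)" using L by (simp add: p_integral_def)
  then have "\<not> int p dvd e"
    using assms by (metis coprime_common_divisor dvd_refl not_prime_unit prime_nat_int_transfer)
  then show "\<exists>a e. \<not> int p dvd e \<and> x = of_int a / of_int e"
    using quotient_of_div[OF q] by blast
next
  assume "\<exists>a e. \<not> int p dvd e \<and> x = of_int a / of_int e"
  then obtain a e where ae: "\<not> int p dvd e" "x = of_int a / of_int e" by blast
  obtain a' e' where q: "quotient_of x = (a', e')" by fastforce
  have "e \<noteq> 0" "e' \<noteq> 0" using ae(1) quotient_of_denom_pos[OF q] by auto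
  then have "of_int (a * e') = (of_int (a' * e) :: rat)"
    using ae(2) quotient_of_div[OF q] by (simp add: field_simps)
  then have "e' dvd a' * e"
    by (metis dvd_triv_right of_int_eq_iff)
  then have "e' dvd e"
    using quotient_of_coprime[OF q] by (simp add: coprime_commute coprime_dvd_mult_right_iff)
  then have "\<not> int p dvd e'" using ae(1) dvd_trans by blast
  then have "coprime (int p) e'"
    using assms by (simp add: prime_imp_coprime)
  then show "p_integral p x" by (simp add: p_integral_def q coprime_commute)
qed

context
  fixes p :: nat
  assumes p: "prime p"
begin

lemma p_integral_of_int [simp]: "p_integral p (of_int a)"
  by (simp add: p_integral_def)

lemma p_integral_add:
  assumes "p_integral p x" "p_integral p y"
  shows "p_integral p (x + y)"
proof -
  obtain a e a' e' where *: "\<not> int p dvd e" "x = of_int a / of_int e"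
    "\<not> int p dvd e'" "y = of_int a' / of_int e'"
    using assms p_integral_iff[OF p] by blast
  have nz: "e \<noteq> 0" "e' \<noteq> 0" using * by auto
  then have "x + y = of_int (a * e' + a' * e) / of_int (e * e')"
    using * by (simp add: field_simps)
  moreover have "\<not> int p dvd e * e'" using * p by (simp add: prime_dvd_mult_iff)
  ultimately show ?thesis using p_integral_iff[OF p] by blast
qed

lemma p_integral_mult:
  assumes "p_integral p x" "p_integral p y"
  shows "p_integral p (x * y)"
proof -
  obtain a e a' e' where *: "\<not> int p dvd e" "x = of_int a / of_int e"
    "\<not> int p dvd e'" "y = of_int a' / of_int e'"
    using assms p_integral_iff[OF p] by blast
  then have "x * y = of_int (a * a') / of_int (e * e')" by simp
  moreover have "\<not> int p dvd e * e'" using * p by (simp add: prime_dvd_mult_iff)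
  ultimately show ?thesis using p_integral_iff[OF p] by blast
qed

lemma p_integral_uminus: "p_integral p x \<Longrightarrow> p_integral p (- x)"
  using p_integral_mult[of "of_int (- 1)" x] p_integral_of_int[of "- 1"] by simp

lemma rat_cong_of_int:
  assumes "[a = b] (mod int p)"
  shows "rat_cong p (of_int a) (of_int b)"
proof -
  obtain k where "a - b = int p * k" using assms by (auto simp: cong_iff_dvd_diff)
  then have "of_int a - of_int b = of_nat p * (of_int k :: rat)"
    by (metis of_int_diff of_int_mult of_int_of_nat_eq)
  then show ?thesis unfolding rat_cong_def by (metis p_integral_of_int)
qed

lemma rat_cong_sym: "rat_cong p x y \<Longrightarrow> rat_cong p y x"
  unfolding rat_cong_def by (metis minus_diff_eq mult_minus_right p_integral_uminus)

lemma rat_cong_add: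
  assumes "rat_cong p x y" "rat_cong p x' y'"
  shows "rat_cong p (x + x') (y + y')"
proof -
  obtain z z' where "p_integral p z" "x - y = of_nat p * z"
    "p_integral p z'" "x' - y' = of_nat p * z'"
    using assms unfolding rat_cong_def by blast
  then have "p_integral p (z + z')" "(x + x') - (y + y') = of_nat p * (z + z')"
    by (simp_all add: p_integral_add algebra_simps)
  then show ?thesis
    using assms unfolding rat_cong_def by (meson p_integral_add)
qed

lemma rat_cong_trans:
  assumes "rat_cong p x y" "rat_cong p y z"
  shows "rat_cong p x z"
proof -
  obtain u u' where "p_integral p u" "x - y = of_nat p * u"
    "p_integral p u'" "y - z = of_nat p * u'"
    using assms unfolding rat_cong_def by blast
  then have "p_integral p (u + u')" "x - z = of_nat p * (u + u')"
    by (simp_all add: p_integral_add algebra_simps)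
  then show ?thesis
    using assms unfolding rat_cong_def by blast
qed

lemma rat_cong_mult:
  assumes "rat_cong p x y" "rat_cong p x' y'"
  shows "rat_cong p (x * x') (y * y')"
proof -
  obtain z z' where z: "p_integral p z" "x - y = of_nat p * z"
    "p_integral p z'" "x' - y' = of_nat p * z'"
    using assms unfolding rat_cong_def by blast
  have i: "p_integral p x" "p_integral p x'" "p_integral p y" "p_integral p y'"
    using assms unfolding rat_cong_def by auto
  have "x * x' - y * y' = (x - y) * x' + y * (x' - y')" by (simp add: algebra_simps)
  also have "\<dots> = of_nat p * (z * x' + y * z')"
    unfolding z by (simp add: algebra_simps)
  finally have "x * x' - y * y' = of_nat p * (z * x' + y * z')" .
  moreover have "p_integral p (z * x' + y * z')"
    using i z by (intro p_integral_add p_integral_mult)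
  ultimately show ?thesis
    using i unfolding rat_cong_def by (meson p_integral_mult)
qed

lemma rat_cong_power:
  assumes "rat_cong p x y"
  shows "rat_cong p (x ^ k) (y ^ k)"
proof (induction k)
  case 0
  then show ?case using rat_cong_of_int[of 1 1] by simp
next
  case (Suc k)
  then show ?case using rat_cong_mult[OF assms] by simp
qed

lemma rat_cong_sum:
  assumes "finite K" "\<And>k. k \<in> K \<Longrightarrow> rat_cong p (f k) (g k)"
  shows "rat_cong p (sum f K) (sum g K)"
  using assms
proof (induction K rule: finite_induct)
  case empty
  then show ?case using rat_cong_of_int[of 0 0] by simp
next
  case (insert k K)
  then show ?case by (simp add: rat_cong_add)
qed

text \<open>Replaces a fraction by an integer residue, so that the rest of the argument can take
  place in the integers modulo \<open>p\<close>.\<close>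

lemma rat_cong_divide:
  assumes "\<not> int p dvd e" "[a = e * z] (mod int p)"
  shows "rat_cong p (of_int a / of_int e) (of_int z)"
proof -
  obtain k where k: "a - e * z = int p * k" using assms(2) by (auto simp: cong_iff_dvd_diff)
  have "e \<noteq> 0" using assms(1) by auto
  then have "of_int a / of_int e - of_int z = (of_int (a - e * z) :: rat) / of_int e"
    by (simp add: field_simps)
  also have "\<dots> = of_nat p * (of_int k / of_int e)" unfolding k by simp
  finally show ?thesis
    using assms(1) p_integral_iff[OF p] p_integral_of_int unfolding rat_cong_def by blast
qed

end

section \<open>Sums of central binomial coefficients\<close>

text \<open>Both sides are 1 at \<open>j = 0\<close> and satisfy the same first-order recursion
  modulo \<open>p\<close>, after multiplication by \<open>Suc j\<close>.\<close>

lemma central_binomial_cong: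
  fixes p h j :: nat
  assumes "prime p" "p = 2 * h + 1" "j \<le> h"
  shows "[int ((2 * j) choose j) = (- 4) ^ j * int (h choose j)] (mod int p)"
  using assms(3)
proof (induction j)
  case (Suc j)
  then have IH: "[int ((2 * j) choose j) = (- 4) ^ j * int (h choose j)] (mod int p)" by simp
  have "Suc j * ((2 * Suc j) choose Suc j) = 2 * (2 * j + 1) * ((2 * j) choose j)"
  proof -
    have "Suc j * (Suc (Suc (2 * j)) choose Suc j) = Suc (Suc (2 * j)) * (Suc (2 * j) choose j)"
      by (rule Suc_times_binomial)
    also have "Suc (2 * j) choose j = Suc (2 * j) choose Suc j"
      using binomial_symmetric[of j "Suc (2 * j)"] by (simp add: Suc_diff_le)
    also have "Suc (Suc (2 * j)) * (Suc (2 * j) choose Suc j) = 2 * (Suc j * (Suc (2 * j) choose Suc j))"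
      by simp
    also have "Suc j * (Suc (2 * j) choose Suc j) = Suc (2 * j) * ((2 * j) choose j)"
      by (rule Suc_times_binomial)
    finally show ?thesis by (simp add: algebra_simps)
  qed
  then have 1: "int (Suc j) * int ((2 * Suc j) choose Suc j) = 2 * (2 * int j + 1) * int ((2 * j) choose j)"
    by (metis (no_types, lifting) of_nat_1 of_nat_add of_nat_mult of_nat_numeral)
  have "Suc j * (h choose Suc j) = (h - j) * (h choose j)"
    by (metis Suc_times_binomial_add Suc_times_binomial binomial_absorb_comp binomial_absorption mult.commute)
  then have 2: "int (Suc j) * int (h choose Suc j) = (int h - int j) * int (h choose j)"
    using Suc.prems by (metis Suc_leD of_nat_diff of_nat_mult)
  have main: "[2 * (2 * int j + 1) * int ((2 * j) choose j)
      = (- 4 * (int h - int j)) * ((- 4) ^ j * int (h choose j))] (mod int p)"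
  proof (rule cong_mult[OF _ IH])
    \<comment> \<open>The factors of the two recursions differ by 4h + 2 = 2p.\<close>
    have "2 * (2 * int j + 1) - (- 4 * (int h - int j)) = int p * 2"
      using assms(2) by simp
    then show "[2 * (2 * int j + 1) = - 4 * (int h - int j)] (mod int p)"
      by (metis cong_iff_dvd_diff dvd_triv_left)
  qed
  have "[int (Suc j) * int ((2 * Suc j) choose Suc j)
      = int (Suc j) * ((- 4) ^ Suc j * int (h choose Suc j))] (mod int p)"
  proof -
    have "int (Suc j) * ((- 4) ^ Suc j * int (h choose Suc j))
        = (- 4) ^ Suc j * (int (Suc j) * int (h choose Suc j))"
      by (rule mult.left_commute)
    also have "\<dots> = (- 4 * (int h - int j)) * ((- 4) ^ j * int (h choose j))"
      unfolding 2 by (simp add: algebra_simps)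
    finally show ?thesis
      unfolding 1 using main by argo
  qed
  \<comment> \<open>The factor \<open>Suc j\<close> can be cancelled since it is positive and at
    most \<open>h\<close>, hence less than \<open>p\<close>.\<close>
  moreover have "coprime (int (Suc j)) (int p)"
  proof -
    have "\<not> p dvd Suc j" using Suc.prems assms(2) by (auto dest: dvd_imp_le)
    then have "coprime p (Suc j)" by (rule prime_imp_coprime[OF assms(1)])
    then show ?thesis by (simp only: coprime_int_iff coprime_commute)
  qed
  ultimately show ?case by (simp only: cong_mult_lcancel)
qed simp

text \<open>The sum gets an integer representative \<open>S\<close>, and the congruence is stated
  for 2 S, so that no division is required. With p = 4n + 1 the exponent \<open>h\<close> = (p-1)/2
  is 2n, and its even binomial indices 2k are those with \<open>k\<close> in 0..n, the range of the
  sum.\<close>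

lemma central_sum_cong:
  fixes p :: nat and y :: int
  assumes "prime p" "[p = 1] (mod 4)" "rat_cong p x (of_int (y\<^sup>2))"
  obtains S where "rat_cong p (central_sum p x) (of_int S)"
    "[2 * S = Legendre (1 - 4 * y) (int p) + Legendre (1 + 4 * y) (int p)] (mod int p)"
proof
  define n where "n = (p - 1) div 4"
  define S where "S = (\<Sum>k = 0..n. int ((4 * k) choose (2 * k)) * (y\<^sup>2) ^ k)"
  have p2: "2 < p" using assms(1,2) prime_ge_2_nat[of p] by (cases "p = 2") (auto simp: cong_def)
  have pn: "p = 2 * (2 * n) + 1" using assms(2) p2 unfolding n_def cong_def by presburger
  have "rat_cong p (of_nat ((4 * k) choose (2 * k)) * x ^ k)
      (of_nat ((4 * k) choose (2 * k)) * of_int (y\<^sup>2) ^ k)" for k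
    using rat_cong_mult[OF assms(1) rat_cong_of_int rat_cong_power[OF assms(1,3)]]
      assms(1) by (metis cong_refl of_int_of_nat_eq)
  then have "rat_cong p (central_sum p x)
      (\<Sum>k = 0..n. of_nat ((4 * k) choose (2 * k)) * of_int (y\<^sup>2) ^ k)"
    unfolding central_sum_def n_def by (intro rat_cong_sum assms(1)) auto
  then show "rat_cong p (central_sum p x) (of_int S)"
    by (simp add: S_def)
  have half: "(p - 1) div 2 = 2 * n" using pn by simp
  let ?f = "\<lambda>z j. of_nat ((2 * n) choose j) * z ^ j :: int"
  have pow: "(z + 1) ^ (2 * n) = sum (?f z) {..2 * n}" for z
    using binomial_ring[of z 1 "2 * n"] by simp
  \<comment> \<open>Adding the expansions at \<open>z\<close> and \<open>-z\<close> cancels the odd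
    powers and doubles the even ones.\<close>
  have even_part: "sum (?f z) {..2 * n} + sum (?f (- z)) {..2 * n}
      = 2 * (\<Sum>k = 0..n. ?f z (2 * k))" for z
  proof -
    have "sum (?f z) {..2 * n} + sum (?f (- z)) {..2 * n}
        = (\<Sum>j\<le>2 * n. if even j then 2 * ?f z j else 0)"
      unfolding sum.distrib[symmetric] by (rule sum.cong) auto
    also have "\<dots> = (\<Sum>j\<in>{j. j \<le> 2 * n \<and> even j}. 2 * ?f z j)"
      by (rule sum.mono_neutral_cong_right) auto
    also have "{j. j \<le> 2 * n \<and> even j} = (\<lambda>k. 2 * k) ` {0..n}"
      by (auto elim!: evenE)
    also have "(\<Sum>j\<in>\<dots>. 2 * ?f z j) = (\<Sum>k = 0..n. 2 * ?f z (2 * k))"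
      by (subst sum.reindex) (auto simp: inj_on_def)
    finally show ?thesis by (simp add: sum_distrib_left)
  qed
  have "[S = (\<Sum>k = 0..n. ?f (4 * y) (2 * k))] (mod int p)"
    unfolding S_def
  proof (rule cong_sum)
    fix k assume k: "k \<in> {0..n}"
    \<comment> \<open>At the even index 2k the power of -4 is 16^k, which combines with y^(2k) into
      (4y)^(2k).\<close>
    have "[int ((4 * k) choose (2 * k)) = (- 4) ^ (2 * k) * int ((2 * n) choose (2 * k))] (mod int p)"
      using central_binomial_cong[OF assms(1) pn, of "2 * k"] k by simp
    then have "[int ((4 * k) choose (2 * k)) * (y\<^sup>2) ^ k
        = ((- 4) ^ (2 * k) * int ((2 * n) choose (2 * k))) * (y\<^sup>2) ^ k] (mod int p)"
      by (rule cong_scalar_right)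
    also have "((- 4) ^ (2 * k) * int ((2 * n) choose (2 * k))) * (y\<^sup>2) ^ k = ?f (4 * y) (2 * k)"
      by (simp add: power_mult power_mult_distrib)
    finally show "[int ((4 * k) choose (2 * k)) * (y\<^sup>2) ^ k = ?f (4 * y) (2 * k)] (mod int p)" .
  qed
  then have "[2 * S = 2 * (\<Sum>k = 0..n. ?f (4 * y) (2 * k))] (mod int p)"
    by (rule cong_scalar_left)
  also have "2 * (\<Sum>k = 0..n. ?f (4 * y) (2 * k)) = (1 - 4 * y) ^ (2 * n) + (1 + 4 * y) ^ (2 * n)"
    using even_part[of "4 * y"] pow[of "4 * y"] pow[of "- (4 * y)"] by (simp add: add.commute)
  finally have S2: "[2 * S = (1 - 4 * y) ^ (2 * n) + (1 + 4 * y) ^ (2 * n)] (mod int p)" .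
  have euler: "[z ^ (2 * n) = Legendre z (int p)] (mod int p)" for z
    using cong_sym[OF euler_criterion[OF assms(1) p2, of z]] unfolding half .
  from S2 cong_add[OF euler euler]
  show "[2 * S = Legendre (1 - 4 * y) (int p) + Legendre (1 + 4 * y) (int p)] (mod int p)"
    by (rule cong_trans)
qed

section \<open>Primes that are sums of two squares\<close>

context
  fixes p :: nat and c d :: int
  assumes p: "prime p" and p_mod_4: "[p = 1] (mod 4)" and p_eq: "int p = c\<^sup>2 + d\<^sup>2"
    and even_d: "2 dvd d"
begin

section \<open>The quadratic characters of c, d and 2 modulo p\<close>

lemma prime_int_p: "prime (int p)" "2 < int p" "[int p = 1] (mod 4)"
proof -
  show "prime (int p)" using p by simp
  show 4: "[int p = 1] (mod 4)"
    using p_mod_4 cong_int_iff[of p 1 4] by simp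
  have "p \<noteq> 2" using p_mod_4 by (auto simp: cong_def)
  then show "2 < int p" using prime_ge_2_nat[OF p] by simp
qed

lemmas Legendre_mult_p = Legendre_mult[OF prime_int_p(1,2)]

lemma odd_c: "odd c"
proof -
  have "odd (int p)" using prime_int_p prime_odd_int by blast
  then show ?thesis using even_d p_eq by simp
qed

text \<open>The reciprocity lemma with \<open>u = 1\<close>, \<open>v = 0\<close> and
  \<open>e = n = 1\<close>, where u c + v d is just \<open>c\<close>.\<close>

lemma Legendre_c: "Legendre c (int p) = 1"
  using Legendre_sum_squares_reciprocity(1)[OF prime_int_p(1,3) p_eq, of 1 0 1 1]
    odd_c prime_int_p Jacobi_square[of 1 c] by (simp add: Jacobi_unit)

lemma not_dvd_two: "\<not> int p dvd 2"
  using prime_int_p(2) zdvd_imp_le by fastforce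

text \<open>(c + d)^2 is congruent to 2cd modulo \<open>p\<close>, so 2cd is a nonzero square, and
  (c/p) = 1.\<close>

lemma Legendre_d: "Legendre d (int p) = Legendre 2 (int p)"
proof -
  have c: "\<not> int p dvd c" using Legendre_c Legendre_eq_0_iff[of c "int p"] by simp
  have d: "\<not> int p dvd d"
  proof
    assume "int p dvd d"
    then have "int p dvd int p - d\<^sup>2" by (simp add: power2_eq_square)
    then show False using c p_eq prime_int_p(1) by (simp add: prime_dvd_power_iff)
  qed
  have "[(c + d)\<^sup>2 = 2 * c * d] (mod int p)"
    unfolding p_eq cong_iff_dvd_diff by (simp add: power2_eq_square algebra_simps)
  moreover from this have "\<not> int p dvd c + d"
    using c d not_dvd_two prime_int_p(1)
    by (metis cong_dvd_iff dvd_mult2 power2_eq_square prime_dvd_mult_iff)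
  ultimately have "Legendre (2 * c * d) (int p) = 1"
    using Legendre_cong Legendre_square[OF prime_int_p(1)] by metis
  then have "Legendre 2 (int p) * Legendre d (int p) = 1"
    by (simp add: Legendre_mult_p Legendre_c)
  then show ?thesis using Legendre_range[of d "int p"] Legendre_range[of 2 "int p"] by auto
qed

text \<open>An odd square is 1 modulo 8, so \<open>p\<close> is 1 + 4 (d/2)^2 modulo 8. This is the
  source of the sign (-1)^(d/2) in the theorem.\<close>

lemma Legendre_two_p: "Legendre 2 (int p) = (if even (d div 2) then 1 else - 1)"
proof -
  obtain d' where d': "d = 2 * d'" using even_d by auto
  obtain c' where c': "c = 2 * c' + 1" using odd_c by (auto elim: oddE)
  have "even (c' * (c' + 1))" by simp
  then obtain l where l: "c' * (c' + 1) = 2 * l" by blast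
  have "int p = 4 * (c' * (c' + 1)) + 1 + 4 * d'\<^sup>2"
    unfolding p_eq c' d' by (simp add: power2_eq_square algebra_simps)
  then have P: "int p = 8 * l + 1 + 4 * d'\<^sup>2" unfolding l by simp
  have "int p mod 8 \<in> {1, 7} \<longleftrightarrow> even (d'\<^sup>2)" 
  proof -
    define z where "z = d'\<^sup>2"
    show ?thesis unfolding P z_def[symmetric] by simp presburger
  qed
  then show ?thesis using Legendre_two[OF prime_int_p(1,2)] d' by simp
qed

text \<open>Common form of both sums in the theorem: \<open>e = b\<close>, \<open>f = 2 * m\<close>
  gives the argument -m^2/(4b^2), and \<open>e = 2 * m\<close>, \<open>f = - b\<close> gives
  -b^2/(64m^2).\<close>

lemma central_sum_Legendre:
  fixes e f :: int
  assumes "\<not> int p dvd e" "\<not> int p dvd e\<^sup>2 + f\<^sup>2"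
  shows "rat_cong p (of_int (Legendre e (int p)) *
           central_sum p (- ((of_int f)\<^sup>2 / (16 * (of_int e)\<^sup>2))))
         (of_int (if Legendre (e\<^sup>2 + f\<^sup>2) (int p) = 1 then Legendre (e * c + f * d) (int p) else 0))"
proof -
  let ?L = "\<lambda>z. Legendre z (int p)"
  have c: "\<not> int p dvd c" using Legendre_c Legendre_eq_0_iff[of c "int p"] by simp
  have four: "\<not> int p dvd 4" using not_dvd_two prime_int_p(1) prime_dvd_mult_iff[of "int p" 2 2] by simp
  then have "\<not> int p dvd 4 * e * c"
    using assms(1) c prime_int_p(1) by (simp add: prime_dvd_mult_iff)
  then have "coprime (4 * e * c) (int p)"
    using prime_imp_coprime[OF prime_int_p(1)] coprime_commute by blast
  then obtain i where i: "[(4 * e * c) * i = 1] (mod int p)"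
    using cong_solve_coprime_int by blast
  \<comment> \<open>Modulo \<open>p\<close> this is fd/(4ec); its square is -f^2/(16e^2) because d^2
    is congruent to -c^2.\<close>
  define y where "y = i * (f * d)"
  have y: "[4 * e * c * y = f * d] (mod int p)"
    using cong_scalar_right[OF i, of "f * d"] by (simp add: y_def mult.assoc)
  have "rat_cong p (of_int (- (f\<^sup>2)) / of_int (16 * e\<^sup>2)) (of_int (y\<^sup>2))"
  proof (rule rat_cong_divide[OF p])
    have "int p dvd 16 \<longleftrightarrow> int p dvd 4"
      using prime_dvd_mult_iff[OF prime_int_p(1), of 4 4] by simp
    then show "\<not> int p dvd 16 * e\<^sup>2"
      using four assms(1) prime_int_p(1) by (simp add: prime_dvd_mult_iff prime_dvd_power_iff)
    have "[(4 * e * c * y)\<^sup>2 = (f * d)\<^sup>2] (mod int p)"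
      using y by (rule cong_pow)
    moreover have "[(f * d)\<^sup>2 = c\<^sup>2 * - (f\<^sup>2)] (mod int p)"
      unfolding p_eq cong_iff_dvd_diff
      by (rule dvdI[of _ _ "f\<^sup>2"]) (simp add: power2_eq_square algebra_simps)
    ultimately have "[c\<^sup>2 * (16 * e\<^sup>2 * y\<^sup>2) = c\<^sup>2 * - (f\<^sup>2)] (mod int p)"
      by (auto simp: power_mult_distrib ac_simps intro: cong_trans)
    moreover have "coprime (c\<^sup>2) (int p)"
      using c prime_imp_coprime[OF prime_int_p(1), of c] by (simp add: coprime_commute)
    ultimately show "[- (f\<^sup>2) = 16 * e\<^sup>2 * y\<^sup>2] (mod int p)"
      using cong_mult_lcancel cong_sym by blast
  qed
  then have "rat_cong p (- ((of_int f)\<^sup>2 / (16 * (of_int e)\<^sup>2))) (of_int (y\<^sup>2))" by simp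
  then obtain S where S: "rat_cong p (central_sum p (- ((of_int f)\<^sup>2 / (16 * (of_int e)\<^sup>2)))) (of_int S)"
    "[2 * S = ?L (1 - 4 * y) + ?L (1 + 4 * y)] (mod int p)"
    using central_sum_cong[OF p p_mod_4] by blast
  have L: "?L e * ?L (1 - 4 * y) = ?L (e * c - f * d)" "?L e * ?L (1 + 4 * y) = ?L (e * c + f * d)"
  proof -
    have "?L e * ?L (1 - 4 * y) = ?L (e * c * (1 - 4 * y))"
      by (simp add: Legendre_mult_p Legendre_c)
    also have "e * c * (1 - 4 * y) = e * c - 4 * e * c * y" by (simp add: algebra_simps)
    also have "?L \<dots> = ?L (e * c - f * d)"
      by (intro Legendre_cong cong_diff cong_refl y)
    finally show "?L e * ?L (1 - 4 * y) = ?L (e * c - f * d)" .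
    have "?L e * ?L (1 + 4 * y) = ?L (e * c * (1 + 4 * y))"
      by (simp add: Legendre_mult_p Legendre_c)
    also have "e * c * (1 + 4 * y) = e * c + 4 * e * c * y" by (simp add: algebra_simps)
    also have "?L \<dots> = ?L (e * c + f * d)"
      by (intro Legendre_cong cong_add cong_refl y)
    finally show "?L e * ?L (1 + 4 * y) = ?L (e * c + f * d)" .
  qed
  have prod: "?L (e * c - f * d) * ?L (e * c + f * d) = ?L (e\<^sup>2 + f\<^sup>2)"
  proof -
    have "?L (e * c - f * d) * ?L (e * c + f * d) = ?L ((e * c - f * d) * (e * c + f * d))"
      by (simp add: Legendre_mult_p)
    also have "\<dots> = ?L (c * (c * (e\<^sup>2 + f\<^sup>2)))"
    proof (rule Legendre_cong)
      show "[(e * c - f * d) * (e * c + f * d) = c * (c * (e\<^sup>2 + f\<^sup>2))] (mod int p)"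
        unfolding p_eq cong_iff_dvd_diff
        by (rule dvdI[of _ _ "- (f\<^sup>2)"]) (simp add: power2_eq_square algebra_simps)
    qed
    finally show ?thesis by (simp add: Legendre_mult_p Legendre_c)
  qed
  let ?V = "if ?L (e\<^sup>2 + f\<^sup>2) = 1 then ?L (e * c + f * d) else 0"
  \<comment> \<open>Both symbols are 1 or -1: they are equal if their product is 1 and cancel if it
    is -1.\<close>
  have "?L (e * c - f * d) + ?L (e * c + f * d) = 2 * ?V"
    using prod assms(2) Legendre_eq_0_iff[of "e\<^sup>2 + f\<^sup>2" "int p"]
      Legendre_range[of "e * c - f * d" "int p"] Legendre_range[of "e * c + f * d" "int p"]
    by auto
  moreover have "[2 * (?L e * S) = ?L e * (?L (1 - 4 * y) + ?L (1 + 4 * y))] (mod int p)"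
    using cong_scalar_left[OF S(2), of "?L e"] by (simp add: ac_simps)
  ultimately have "[2 * (?L e * S) = 2 * ?V] (mod int p)"
    by (simp add: distrib_left L)
  moreover have "coprime 2 (int p)"
    using prime_imp_coprime[OF prime_int_p(1) not_dvd_two] coprime_commute by blast
  ultimately have "[?L e * S = ?V] (mod int p)"
    using cong_mult_lcancel by blast
  then have "rat_cong p (of_int (?L e * S)) (of_int ?V)"
    by (rule rat_cong_of_int[OF p])
  moreover have "rat_cong p (of_int (?L e) *
      central_sum p (- ((of_int f)\<^sup>2 / (16 * (of_int e)\<^sup>2)))) (of_int (?L e * S))"
    using rat_cong_mult[OF p rat_cong_of_int[OF p cong_refl] S(1)] by simp
  ultimately show ?thesis using rat_cong_trans[OF p] by blast
qed

text \<open>The common residue of the two sums, kept as a Legendre symbol modulo \<open>p\<close>.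
  Both sums are compared with it, and the four cases of the theorem only rewrite it.\<close>

definition central_value :: "int \<Rightarrow> int \<Rightarrow> int" where
  "central_value b m = (if Legendre (b\<^sup>2 + 4 * m\<^sup>2) (int p) = 1
     then Legendre (b * c + 2 * m * d) (int p) else 0)"

lemma central_sums_value:
  fixes b m :: int
  assumes "\<not> int p dvd m * (b\<^sup>2 + 4 * m\<^sup>2)"
  shows "rat_cong p (of_int (Legendre m (int p)) *
           central_sum p (- ((of_int b)\<^sup>2 / (64 * (of_int m)\<^sup>2)))) (of_int (central_value b m))"
    and "\<not> int p dvd b \<Longrightarrow> rat_cong p (of_int (Legendre b (int p)) *
           central_sum p (- ((of_int m)\<^sup>2 / (4 * (of_int b)\<^sup>2)))) (of_int (central_value b m))"
proof -
  let ?L = "\<lambda>z. Legendre z (int p)"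
  have N: "\<not> int p dvd b\<^sup>2 + (2 * m)\<^sup>2" and m: "\<not> int p dvd 2 * m"
    using assms not_dvd_two prime_int_p(1) by (auto simp: prime_dvd_mult_iff)
  show "rat_cong p (of_int (?L b) * central_sum p (- ((of_int m)\<^sup>2 / (4 * (of_int b)\<^sup>2))))
      (of_int (central_value b m))" if "\<not> int p dvd b"
    using central_sum_Legendre[OF that N] by (simp add: central_value_def power_mult_distrib)
  have two: "?L 2 * ?L 2 = 1"
    using not_dvd_two Legendre_range[of 2 "int p"] Legendre_eq_0_iff[of 2 "int p"] by auto
  \<comment> \<open>The choice \<open>e = 2 * m\<close>, \<open>f = - b\<close> yields the symbol of
    2mc - bd. Multiplying by \<open>d\<close>, which has the same symbol as 2, turns it into that of
    bc + 2md; the extra factor (2/p) also reduces (2m/p) to (m/p).\<close>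
  have "?L 2 * ?L (2 * m * c + - b * d) = ?L (d * (2 * m * c + - b * d))"
    by (simp only: Legendre_mult_p Legendre_d)
  also have "\<dots> = ?L (c * (b * c + 2 * m * d))"
  proof (rule Legendre_cong)
    show "[d * (2 * m * c + - b * d) = c * (b * c + 2 * m * d)] (mod int p)"
      unfolding p_eq cong_iff_dvd_diff
      by (rule dvdI[of _ _ "- b"]) (simp add: power2_eq_square algebra_simps)
  qed
  also have "\<dots> = ?L (b * c + 2 * m * d)" by (simp add: Legendre_mult_p Legendre_c)
  finally have swap: "?L 2 * ?L (2 * m * c + - b * d) = ?L (b * c + 2 * m * d)" .
  have "rat_cong p (of_int (?L 2) * (of_int (?L (2 * m)) *
        central_sum p (- ((of_int (- b))\<^sup>2 / (16 * (of_int (2 * m))\<^sup>2)))))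
      (of_int (?L 2) * of_int (if ?L ((2 * m)\<^sup>2 + (- b)\<^sup>2) = 1 then ?L (2 * m * c + - b * d) else 0))"
    using N m by (intro rat_cong_mult[OF p rat_cong_of_int[OF p cong_refl]] central_sum_Legendre)
      (simp_all add: add.commute)
  also have "of_int (?L 2) * of_int (if ?L ((2 * m)\<^sup>2 + (- b)\<^sup>2) = 1 then ?L (2 * m * c + - b * d) else 0)
      = (of_int (central_value b m) :: rat)"
  proof -
    have N: "(2 * m)\<^sup>2 + (- b)\<^sup>2 = b\<^sup>2 + 4 * m\<^sup>2" by (simp add: power_mult_distrib)
    show ?thesis
      unfolding central_value_def swap[symmetric] N by simp
  qed
  also have "of_int (?L 2) * (of_int (?L (2 * m)) *
        central_sum p (- ((of_int (- b))\<^sup>2 / (16 * (of_int (2 * m))\<^sup>2))))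
      = of_int (?L m) * central_sum p (- ((of_int b)\<^sup>2 / (64 * (of_int m)\<^sup>2)))"
  proof -
    have "of_int (?L 2) * of_int (?L (2 * m)) = (of_int (?L m) :: rat)"
      using two by (metis Legendre_mult_p mult.assoc mult_1 of_int_mult)
    then show ?thesis by (simp add: power_mult_distrib mult.assoc[symmetric])
  qed
  finally show "rat_cong p (of_int (?L m) * central_sum p (- ((of_int b)\<^sup>2 / (64 * (of_int m)\<^sup>2))))
      (of_int (central_value b m))" .
qed

section \<open>Legendre symbols modulo p as Jacobi symbols, by the power of 2 in b\<close>

lemma Legendre_eq_Jacobi_odd_sum_squares:
  fixes u v :: int
  assumes "coprime u v" "\<not> int p dvd u\<^sup>2 + v\<^sup>2" "odd u" "even v"
  shows "Legendre (u * c + v * d) (int p) = Jacobi (u * c + v * d) (u\<^sup>2 + v\<^sup>2)"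
proof -
  have "u \<noteq> 0" using assms(3) by auto
  then have "0 < u\<^sup>2 + v\<^sup>2" by (simp add: add_pos_nonneg)
  \<comment> \<open>The case \<open>e = 1\<close>, where the right-hand side (1/t) is 1.\<close>
  then have "Legendre (u * c + v * d) (int p) * Jacobi (u * c + v * d) (u\<^sup>2 + v\<^sup>2) = 1"
    using Legendre_sum_squares_reciprocity(1)[OF prime_int_p(1,3) p_eq assms(1) _ assms(2),
      of 1 "u\<^sup>2 + v\<^sup>2"] assms(3,4) odd_c Jacobi_square[of 1] by simp
  then show ?thesis
    using Legendre_range[of "u * c + v * d" "int p"] by auto
qed

text \<open>For b = 4k, taking 2 out of bc + 2md leaves 2kc + md, which is still even, so
  reciprocity does not apply to it. Multiplication by \<open>d\<close> passes to the odd number mc -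
  2kd, up to the factor -c of symbol 1, and absorbs (2/p).\<close>

lemma Legendre_value_four_dvd:
  fixes b m :: int
  assumes "coprime b m" "\<not> int p dvd m * (b\<^sup>2 + 4 * m\<^sup>2)" "4 dvd b"
  shows "Legendre (b * c + 2 * m * d) (int p) = Jacobi (m * c - b div 2 * d) (b\<^sup>2 div 4 + m\<^sup>2)"
proof -
  let ?L = "\<lambda>z. Legendre z (int p)"
  obtain k where k: "b = 4 * k" using assms(3) by auto
  have m: "coprime m (- (2 * k))" "odd m"
    using assms(1) unfolding k by (auto simp: coprime_commute)
  have N: "\<not> int p dvd m\<^sup>2 + (- (2 * k))\<^sup>2"
  proof
    assume "int p dvd m\<^sup>2 + (- (2 * k))\<^sup>2"
    then have "int p dvd m * 4 * (m\<^sup>2 + (- (2 * k))\<^sup>2)" by simp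
    also have "\<dots> = m * (b\<^sup>2 + 4 * m\<^sup>2)" unfolding k by (simp add: power2_eq_square algebra_simps)
    finally show False using assms(2) by simp
  qed
  have "?L (b * c + 2 * m * d) = ?L 2 * ?L (2 * k * c + m * d)"
    unfolding Legendre_mult_p[symmetric] k by (simp add: algebra_simps)
  also have "\<dots> = ?L (d * (2 * k * c + m * d))"
    by (simp only: Legendre_mult_p Legendre_d)
  also have "\<dots> = ?L (- 1 * (c * (m * c + - (2 * k) * d)))"
  proof (rule Legendre_cong)
    show "[d * (2 * k * c + m * d) = - 1 * (c * (m * c + - (2 * k) * d))] (mod int p)"
      unfolding p_eq cong_iff_dvd_diff
      by (rule dvdI[of _ _ m]) (simp add: power2_eq_square algebra_simps)
  qed
  also have "\<dots> = ?L (m * c + - (2 * k) * d)"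
    using Legendre_minus_one[OF prime_int_p(1,2)] prime_int_p(3)
    unfolding Legendre_mult_p Legendre_c by simp
  also have "\<dots> = Jacobi (m * c + - (2 * k) * d) (m\<^sup>2 + (- (2 * k))\<^sup>2)"
    using m N by (intro Legendre_eq_Jacobi_odd_sum_squares) auto
  also have "m\<^sup>2 + (- (2 * k))\<^sup>2 = b\<^sup>2 div 4 + m\<^sup>2"
    unfolding k by (simp add: power_mult_distrib)
  finally show ?thesis unfolding k by simp
qed

text \<open>For b = 2k with \<open>k\<close> and \<open>m\<close> odd, k^2 + m^2 is twice an odd
  number, so reciprocity is used with \<open>e = 2\<close>. The sign collects (2/p), from the factor
  2 of bc + 2md, and (2/t).\<close>

lemma Legendre_value_two_exactly_dvd:
  fixes b m :: int
  assumes "coprime b m" "\<not> int p dvd m * (b\<^sup>2 + 4 * m\<^sup>2)" "2 dvd b" "\<not> 4 dvd b"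
  shows "of_int (Legendre (b * c + 2 * m * d) (int p)) =
    (- 1 :: rat) powi (((b div 2 * c + m * d)\<^sup>2 - 1) div 8 + d div 2) *
    of_int (Jacobi (b div 2 * c + m * d) (((b div 2)\<^sup>2 + m\<^sup>2) div 2))"
proof -
  let ?L = "\<lambda>z. Legendre z (int p)"
  obtain k where k: "b = 2 * k" using assms(3) by auto
  have odd: "odd k" "odd m" using assms(1,4) unfolding k by auto
  define t where "t = k * c + m * d"
  define n where "n = (k\<^sup>2 + m\<^sup>2) div 2"
  have t: "odd t" using odd even_d odd_c by (simp add: t_def)
  have n: "k\<^sup>2 + m\<^sup>2 = 2 * n" using odd by (simp add: n_def)
  have N: "\<not> int p dvd k\<^sup>2 + m\<^sup>2"
  proof
    assume "int p dvd k\<^sup>2 + m\<^sup>2"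
    then have "int p dvd m * 4 * (k\<^sup>2 + m\<^sup>2)" by simp
    also have "\<dots> = m * (b\<^sup>2 + 4 * m\<^sup>2)" unfolding k by (simp add: power2_eq_square algebra_simps)
    finally show False using assms(2) by simp
  qed
  have "odd n"
  proof -
    obtain x y where "k = 2 * x + 1" "m = 2 * y + 1" using odd by (auto elim!: oddE)
    then have "n = 2 * (x\<^sup>2 + x + y\<^sup>2 + y) + 1"
      using n by (simp add: power2_eq_square algebra_simps)
    then show ?thesis by (rule ssubst) simp
  qed
  moreover have "0 < n"
  proof -
    have "k \<noteq> 0" using odd by auto
    then have "0 < k\<^sup>2 + m\<^sup>2" by (simp add: add_pos_nonneg)
    then show ?thesis using n by simp
  qed
  ultimately have rec: "?L t * Jacobi t n = Jacobi 2 t" "Jacobi 2 t \<noteq> 0"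
    using Legendre_sum_squares_reciprocity[OF prime_int_p(1,3) p_eq _ n N] assms(1) t
    unfolding k t_def by simp_all
  \<comment> \<open>The symbol (t/n) is nonzero, hence its own inverse, and can be moved to the
    other side.\<close>
  have "Jacobi t n * Jacobi t n = 1"
    using rec Jacobi_range[of t n] by auto
  then have "?L t = Jacobi 2 t * Jacobi t n"
    by (simp add: rec(1)[symmetric] mult.assoc)
  moreover have "?L (b * c + 2 * m * d) = ?L 2 * ?L t"
    unfolding Legendre_mult_p[symmetric] k t_def by (simp add: algebra_simps)
  ultimately have "?L (b * c + 2 * m * d) = (?L 2 * Jacobi 2 t) * Jacobi t n" by simp
  moreover have "(- 1 :: rat) powi ((t\<^sup>2 - 1) div 8 + d div 2) = of_int (?L 2 * Jacobi 2 t)"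
    unfolding Legendre_two_p Jacobi_two[OF t] even_square_minus_one_div_8[OF t, symmetric]
    by (simp add: power_int_minus_left)
  ultimately show ?thesis unfolding k by (simp add: t_def n_def)
qed

end

text \<open>The sums with \<open>b\<close> or \<open>a\<close> in the denominator are meaningful
  modulo \<open>p\<close> only if \<open>p\<close> does not divide that number, so their congruences
  carry this condition. The sign is written with \<open>powi\<close> because its exponent is an
  integer and \<open>d\<close> may be negative.\<close>

theorem theorem2p10:
  fixes p :: nat and c d :: int
  assumes "prime p" and "[p = 1] (mod 4)" and "int p = c\<^sup>2 + d\<^sup>2" and "2 dvd d"
  shows
    "(\<forall>b m :: int. coprime b m \<longrightarrow> \<not> int p dvd m * (b\<^sup>2 + 4 * m\<^sup>2) \<longrightarrow>
       (let A = of_int (Legendre m (int p)) * central_sum p (- ((of_int b)\<^sup>2 / (64 * (of_int m)\<^sup>2)));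
            B = of_int (Legendre b (int p)) * central_sum p (- ((of_int m)\<^sup>2 / (4 * (of_int b)\<^sup>2)));
            C = (if odd b \<and> Legendre (b\<^sup>2 + 4 * m\<^sup>2) (int p) = 1
                   then of_int (Jacobi (b * c + 2 * m * d) (b\<^sup>2 + 4 * m\<^sup>2))
                 else if 2 dvd b \<and> \<not> 4 dvd b \<and> Legendre (b\<^sup>2 + 4 * m\<^sup>2) (int p) = 1
                   then (- 1) powi (((b div 2 * c + m * d)\<^sup>2 - 1) div 8 + d div 2) *
                        of_int (Jacobi (b div 2 * c + m * d) (((b div 2)\<^sup>2 + m\<^sup>2) div 2))
                 else if 4 dvd b \<and> Legendre (b\<^sup>2 + 4 * m\<^sup>2) (int p) = 1
                   then of_int (Jacobi (m * c - b div 2 * d) (b\<^sup>2 div 4 + m\<^sup>2))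
                 else 0)
        in rat_cong p A C \<and> (\<not> int p dvd b \<longrightarrow> rat_cong p A B \<and> rat_cong p B C))) \<and>
     (\<forall>a :: int. \<not> int p dvd 16 * a\<^sup>2 + 1 \<longrightarrow>
       (let A = central_sum p (- ((of_int a)\<^sup>2));
            B = of_int (Legendre (2 * a) (int p)) * central_sum p (1 / (- 256 * (of_int a)\<^sup>2));
            C = (if Legendre (16 * a\<^sup>2 + 1) (int p) = 1
                   then of_int (Jacobi (c - 4 * a * d) (16 * a\<^sup>2 + 1))
                 else 0)
        in rat_cong p A C \<and> (\<not> int p dvd a \<longrightarrow> rat_cong p A B \<and> rat_cong p B C)))"
proof -
  note p = assms
  let ?L = "\<lambda>z. Legendre z (int p)"
  let ?V = "\<lambda>b m. rat_of_int (central_value p c d b m)"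
  have join: "rat_cong p A V \<and> (Q \<longrightarrow> rat_cong p A B \<and> rat_cong p B V)"
    if "rat_cong p A V" "Q \<Longrightarrow> rat_cong p B V" for A B V Q
    using that rat_cong_sym[OF p(1)] rat_cong_trans[OF p(1)] by blast
  have general: "(if odd b \<and> ?L (b\<^sup>2 + 4 * m\<^sup>2) = 1
        then of_int (Jacobi (b * c + 2 * m * d) (b\<^sup>2 + 4 * m\<^sup>2))
      else if 2 dvd b \<and> \<not> 4 dvd b \<and> ?L (b\<^sup>2 + 4 * m\<^sup>2) = 1
        then (- 1) powi (((b div 2 * c + m * d)\<^sup>2 - 1) div 8 + d div 2) *
             of_int (Jacobi (b div 2 * c + m * d) (((b div 2)\<^sup>2 + m\<^sup>2) div 2))
      else if 4 dvd b \<and> ?L (b\<^sup>2 + 4 * m\<^sup>2) = 1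
        then of_int (Jacobi (m * c - b div 2 * d) (b\<^sup>2 div 4 + m\<^sup>2))
      else 0) = ?V b m"
    if bm: "coprime b m" "\<not> int p dvd m * (b\<^sup>2 + 4 * m\<^sup>2)" for b m
  proof (cases "?L (b\<^sup>2 + 4 * m\<^sup>2) = 1")
    case True
    consider "odd b" | "2 dvd b" "\<not> 4 dvd b" | "4 dvd b" by blast
    then show ?thesis
    proof cases
      case 1
      then have "coprime b (2 * m)" using bm(1) by simp
      moreover have "\<not> int p dvd b\<^sup>2 + (2 * m)\<^sup>2" using bm(2) by (auto simp: power_mult_distrib)
      ultimately have "?L (b * c + 2 * m * d) = Jacobi (b * c + 2 * m * d) (b\<^sup>2 + 4 * m\<^sup>2)"
        using Legendre_eq_Jacobi_odd_sum_squares[OF p, of b "2 * m"] 1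
        by (simp add: power_mult_distrib)
      with 1 True show ?thesis by (simp add: central_value_def[OF p])
    next
      case 2
      with True Legendre_value_two_exactly_dvd[OF p bm 2] show ?thesis
        by (simp add: central_value_def[OF p])
    next
      case 3
      moreover from this have "2 dvd b" by (rule dvd_trans[rotated]) simp
      ultimately show ?thesis
        using True Legendre_value_four_dvd[OF p bm 3] by (simp add: central_value_def[OF p])
    qed
  qed (simp add: central_value_def[OF p])
  \<comment> \<open>The particular case is b = 8a, m = 1, which falls under 4 | b: there b^2 + 4m^2
    = 4 (16a^2 + 1), the arguments become -a^2 and -1/(256a^2), and 8a has the symbol of 2a.\<close>
  have special: "(if ?L (16 * a\<^sup>2 + 1) = 1 then of_int (Jacobi (c - 4 * a * d) (16 * a\<^sup>2 + 1)) else 0)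
      = ?V (8 * a) 1"
    and cond: "\<not> int p dvd 1 * ((8 * a)\<^sup>2 + 4 * 1\<^sup>2)"
    and eight: "?L (8 * a) = ?L (2 * a)" "int p dvd 8 * a \<longleftrightarrow> int p dvd a"
    if a: "\<not> int p dvd 16 * a\<^sup>2 + 1" for a
  proof -
    have N: "(8 * a)\<^sup>2 + 4 * 1\<^sup>2 = 2\<^sup>2 * (16 * a\<^sup>2 + 1)" by (simp add: power_mult_distrib)
    have two: "\<not> int p dvd 2" by (rule not_dvd_two[OF p])
    have P: "prime (int p)" "2 < int p" using prime_int_p[OF p] by auto
    have four: "?L (2\<^sup>2 * z) = ?L z" for z
      unfolding Legendre_mult[OF P] Legendre_square[OF P(1) two] by simp
    show cond: "\<not> int p dvd 1 * ((8 * a)\<^sup>2 + 4 * 1\<^sup>2)"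
      unfolding N mult_1 using a two P(1) prime_dvd_mult_iff prime_dvd_power by blast
    show "?L (8 * a) = ?L (2 * a)" using four[of "2 * a"] by simp
    have "int p dvd 2 ^ 3 * a \<longleftrightarrow> int p dvd a"
      using two P(1) prime_dvd_mult_iff prime_dvd_power by blast
    then show "int p dvd 8 * a \<longleftrightarrow> int p dvd a" by simp
    have "?L (8 * a * c + 2 * 1 * d) = Jacobi (1 * c - 8 * a div 2 * d) ((8 * a)\<^sup>2 div 4 + 1\<^sup>2)"
      by (rule Legendre_value_four_dvd[OF p _ cond]) simp_all
    moreover have "(8 * a)\<^sup>2 div 4 = 16 * a\<^sup>2" "8 * a div 2 = 4 * a"
      by (simp_all add: power_mult_distrib)
    ultimately show "(if ?L (16 * a\<^sup>2 + 1) = 1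
        then of_int (Jacobi (c - 4 * a * d) (16 * a\<^sup>2 + 1)) else 0) = ?V (8 * a) 1"
      unfolding central_value_def[OF p] N four by simp
  qed
  have "?L 1 = 1" using Legendre_square[OF prime_int_p(1)[OF p], of 1] prime_int_p(2)[OF p] by simp
  then have specialA: "rat_cong p (central_sum p (- ((of_int a)\<^sup>2))) (?V (8 * a) 1)"
    if "\<not> int p dvd 16 * a\<^sup>2 + 1" for a
    using central_sums_value(1)[OF p cond[OF that]] by (simp add: power_mult_distrib)
  have specialB: "rat_cong p (of_int (?L (2 * a)) * central_sum p (1 / (- 256 * (of_int a)\<^sup>2))) (?V (8 * a) 1)"
    if "\<not> int p dvd 16 * a\<^sup>2 + 1" "\<not> int p dvd a" for a
    using central_sums_value(2)[OF p cond[OF that(1)]] that eight[OF that(1)]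
    by (simp add: power_mult_distrib)
  show ?thesis
    unfolding Let_def
  proof (intro conjI allI impI, goal_cases)
    case (1 b m)
    show ?case unfolding general[OF 1] by (rule central_sums_value(1)[OF p 1(2)])
  next
    case (2 b m)
    show ?case using join[OF central_sums_value(1)[OF p 2(2)] central_sums_value(2)[OF p 2(2)]] 2(3) by blast
  next
    case (3 b m)
    show ?case unfolding general[OF 3(1,2)] by (rule central_sums_value(2)[OF p 3(2,3)])
  next
    case (4 a)
    show ?case unfolding special[OF 4] by (rule specialA[OF 4])
  next
    case (5 a)
    show ?case using join[OF specialA[OF 5(1)] specialB[OF 5(1)]] 5(2) by blast
  next
    case (6 a)
    show ?case unfolding special[OF 6(1)] by (rule specialB[OF 6])
  qed
qed

end
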